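(* Let $S$ be a nonabelian finite simple group, $I$ an infinite set, and $G=S^I$ with the product topology. Then $G$ is not strongly complete, and every normal subgroup $U$ of finite index in $G$ is either open in $G$ or not of profinite type (as an abstract group).
   Context: An abstract group is of profinite type if it admits a topology making it a profinite group. A profinite group is strongly complete if every subgroup of finite index is open. *)

theory Defs
  imports "HOL-Analysis.Analysis" "HOL-Algebra.Product_Groups" "HOL-Algebra.SimpleGroups"
begin

definition profinite_group :: "('a, 'b) monoid_scheme \<Rightarrow> 'a topology \<Rightarrow> bool" where
  "profinite_group G T \<longleftrightarrow>
     group G \<and> topspace T = carrier G \<and>
     continuous_map (prod_topology T T) T (\<lambda>(x, y). x \<otimes>\<^bsub>G\<^esub> y) \<and>
     continuous_map T T (\<lambda>x. inv\<^bsub>G\<^esub> x) \<and>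
     compact_space T \<and> Hausdorff_space T \<and>
     (\<forall>x\<in>topspace T. connected_component_of_set T x = {x})"

definition profinite_type :: "('a, 'b) monoid_scheme \<Rightarrow> bool" where
  "profinite_type G \<longleftrightarrow> (\<exists>T. profinite_group G T)"

definition strongly_complete :: "('a, 'b) monoid_scheme \<Rightarrow> 'a topology \<Rightarrow> bool" where
  "strongly_complete G T \<longleftrightarrow>
     (\<forall>H. subgroup H G \<and> finite (rcosets\<^bsub>G\<^esub> H) \<longrightarrow> openin T H)"

end

theory Submission
  imports Defs "HOL-Algebra.Group_Action"
begin

text \<open>
  A non-open subgroup of finite index comes from a nonprincipal ultrafilter \<open>F\<close> on \<open>I\<close>:
  the elements of \<open>S\<^sup>I\<close> that are trivial \<open>F\<close>-almost everywhere form a subgroup whose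
  right cosets are represented by the constant functions, yet it contains no basic open
  neighbourhood of the identity.

  Conversely, let \<open>U\<close> be a normal subgroup of finite index carrying a profinite topology \<open>T\<close>.
  Since \<open>S\<close> is simple and centreless, at every coordinate \<open>j\<close> either \<open>U\<close> contains the copy of
  \<open>S\<close> at \<open>j\<close>, or \<open>U\<close> is trivial at \<open>j\<close>. In the first case the fibre \<open>{u \<in> U. u j = 1}\<close> is
  the set of elements of \<open>U\<close> commuting with that copy, which is closed in the Hausdorff
  group \<open>(U, T)\<close>, and so are its translates. Hence the inclusion of \<open>(U, T)\<close> into the product
  topology is continuous, \<open>U\<close> is compact and thus closed there, and a closed subgroup of
  finite index is open.
\<close>

lemma (in simple_group) central_eq_one:
  assumes "\<not> comm_group G" and z: "z \<in> carrier G" and "\<forall>x\<in>carrier G. x \<otimes> z = z \<otimes> x"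
  shows "z = \<one>"
proof -
  let ?conj = "\<lambda>g. \<lambda>h \<in> carrier G. g \<otimes> h \<otimes> inv g"
  \<comment> \<open>The centre is the kernel of the conjugation action, hence a normal subgroup.\<close>
  interpret conj: group_hom G "BijGroup (carrier G)" ?conj
    by (simp add: group_hom_def group_hom_axioms_def group_BijGroup conjugation_is_hom is_group)
  have kernel_iff: "g \<in> kernel G (BijGroup (carrier G)) ?conj \<longleftrightarrow> (\<forall>x\<in>carrier G. x \<otimes> g = g \<otimes> x)"
    if g: "g \<in> carrier G" for g
  proof -
    have "?conj g = (\<lambda>x\<in>carrier G. x) \<longleftrightarrow> (\<forall>x\<in>carrier G. g \<otimes> x \<otimes> inv g = x)"
      by (auto intro: restrict_ext dest: fun_cong[where x = x for x] split: if_splits)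
    also have "\<dots> \<longleftrightarrow> (\<forall>x\<in>carrier G. x \<otimes> g = g \<otimes> x)"
      using g by (metis inv_solve_right m_closed)
    finally show ?thesis
      using g by (simp add: kernel_def BijGroup_def)
  qed
  have "kernel G (BijGroup (carrier G)) ?conj \<noteq> carrier G"
  proof
    assume "kernel G (BijGroup (carrier G)) ?conj = carrier G"
    then have "comm_group G"
      using kernel_iff by (intro group_comm_groupI) auto
    with assms(1) show False ..
  qed
  then have "kernel G (BijGroup (carrier G)) ?conj = {\<one>}"
    using no_real_normal_subgroup[OF conj.normal_kernel] by blast
  then show ?thesis
    using kernel_iff[OF z] assms(3) z by blast
qed

lemma (in group_hom) normal_vimage:
  assumes "N \<lhd> H"
  shows "{x \<in> carrier G. h x \<in> N} \<lhd> G"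
proof -
  interpret N: normal N H by fact
  show ?thesis
    unfolding G.normal_inv_iff
  proof (intro conjI ballI G.subgroupI)
    show "{x \<in> carrier G. h x \<in> N} \<noteq> {}"
      using N.one_closed by force
    fix x y assume "x \<in> {x \<in> carrier G. h x \<in> N}"
    then show "inv x \<in> {x \<in> carrier G. h x \<in> N}"
      by auto
    assume "y \<in> {x \<in> carrier G. h x \<in> N}"
    then show "x \<otimes> y \<in> {x \<in> carrier G. h x \<in> N}"
      using \<open>x \<in> _\<close> by auto
  next
    fix x y assume "x \<in> carrier G" "y \<in> {x \<in> carrier G. h x \<in> N}"
    then show "x \<otimes> y \<otimes> inv x \<in> {x \<in> carrier G. h x \<in> N}"
      using N.inv_op_closed2 by auto
  qed auto
qed

lemma (in group) commute_of_commutator_eq_one: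
  assumes x: "x \<in> carrier G" and y: "y \<in> carrier G" and "x \<otimes> y \<otimes> inv x \<otimes> inv y = \<one>"
  shows "x \<otimes> y = y \<otimes> x"
proof -
  have "x \<otimes> y \<otimes> inv x = y"
    using assms inv_solve_right[of \<one> "x \<otimes> y \<otimes> inv x" y] by auto
  then show ?thesis
    using x y inv_solve_right[of y "x \<otimes> y" x] by auto
qed

lemma (in group) Union_rcosets_Diff_self:
  assumes "subgroup H G"
  shows "\<Union> (rcosets H - {H}) = carrier G - H"
proof (intro equalityI subsetI)
  interpret H: subgroup H G by fact
  have "H \<in> rcosets H"
    using rcosetsI[OF H.subset one_closed] coset_mult_one[OF H.subset] by simp
  then have disjoint: "X \<inter> H = {}" if "X \<in> rcosets H" "X \<noteq> H" for X
    using pairwiseD[OF rcos_disjoint[OF assms]] that by (simp add: disjnt_def)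
  fix x assume "x \<in> \<Union> (rcosets H - {H})"
  then obtain X where "X \<in> rcosets H" "X \<noteq> H" "x \<in> X"
    by blast
  then show "x \<in> carrier G - H"
    using rcosets_part_G[OF assms] disjoint by blast
next
  fix x assume x: "x \<in> carrier G - H"
  then obtain X where "X \<in> rcosets H" "x \<in> X"
    using rcosets_part_G[OF assms] by blast
  then show "x \<in> \<Union> (rcosets H - {H})"
    using x by blast
qed

section \<open>Ultrafilters\<close>

definition ultrafilter :: "'a filter \<Rightarrow> bool" where
  "ultrafilter F \<longleftrightarrow> F \<noteq> bot \<and> (\<forall>P. eventually P F \<or> eventually (\<lambda>x. \<not> P x) F)"

lemma ultrafilter_le_exists:
  fixes F :: "'a filter"
  assumes "F \<noteq> bot"
  shows "\<exists>U. ultrafilter U \<and> U \<le> F"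
proof -
  let ?R = "{(b, a). a \<noteq> bot \<and> a \<le> b \<and> b \<le> F}"
  have [simp]: "Field ?R = {G. G \<noteq> bot \<and> G \<le> F}"
    by (auto simp: Field_def bot_unique)
  have "\<exists>m\<in>Field ?R. \<forall>a\<in>Field ?R. (m, a) \<in> ?R \<longrightarrow> a = m"
  proof (rule Zorns_po_lemma)
    show "Partial_order ?R"
      by (auto simp: partial_order_on_def preorder_on_def antisym_def refl_on_def trans_def
          Field_def bot_unique)
    show "\<exists>u\<in>Field ?R. \<forall>a\<in>C. (a, u) \<in> ?R" if C: "C \<in> Chains ?R" for C
    proof (simp, intro exI conjI ballI)
      have Inf_C: "Inf C \<noteq> bot" "Inf C \<le> F" if "C \<noteq> {}"
      proof -
        from C that have "Inf C = bot \<longleftrightarrow> (\<exists>x\<in>C. x = bot)"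
          unfolding trivial_limit_def by (intro eventually_Inf_base) (auto simp: Chains_def)
        with C show "Inf C \<noteq> bot"
          by (auto simp: Chains_def)
        from that obtain x where "x \<in> C" by auto
        with C show "Inf C \<le> F"
          by (auto intro!: Inf_lower2[of x] simp: Chains_def)
      qed
      then have [simp]: "inf F (Inf C) = (if C = {} then F else Inf C)"
        by (auto simp add: inf_absorb2)
      show "inf F (Inf C) \<noteq> bot" "inf F (Inf C) \<le> F"
        using assms Inf_C by simp_all
      with C show "inf F (Inf C) \<le> x" "x \<le> F" if "x \<in> C" for x
        using that by (auto intro: Inf_lower simp: Chains_def)
    qed
  qed
  then obtain U where U: "U \<noteq> bot" "U \<le> F" and max: "\<And>G. G \<noteq> bot \<Longrightarrow> G \<le> U \<Longrightarrow> U = G"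
    by auto (metis order_trans)
  have "eventually P U \<or> eventually (\<lambda>x. \<not> P x) U" for P
  proof (rule disjCI)
    assume "\<not> (\<forall>\<^sub>F x in U. \<not> P x)"
    then have "inf U (principal {x. P x}) \<noteq> bot"
      by (simp add: trivial_limit_def eventually_inf_principal not_eventually)
    then have U_eq: "U = inf U (principal {x. P x})"
      by (rule max) simp
    show "eventually P U"
      by (subst U_eq) (simp add: eventually_inf_principal)
  qed
  then show ?thesis
    using U unfolding ultrafilter_def by blast
qed

lemma ultrafilter_eventually_finite_ex:
  assumes "ultrafilter F" and "finite A" and "eventually (\<lambda>x. \<exists>a\<in>A. P a x) F"
  shows "\<exists>a\<in>A. eventually (P a) F"
  using assms(2,3)
proof (induction A rule: finite_induct)
  case empty
  then show ?case
    using assms(1) by (simp add: ultrafilter_def trivial_limit_def)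
next
  case (insert b A)
  show ?case
  proof (cases "eventually (P b) F")
    case False
    then have "eventually (\<lambda>x. \<not> P b x) F"
      using assms(1) by (auto simp: ultrafilter_def)
    with insert.prems have "eventually (\<lambda>x. \<exists>a\<in>A. P a x) F"
      by eventually_elim auto
    then show ?thesis
      using insert.IH by auto
  qed auto
qed

section \<open>Subgroups of products of discrete groups\<close>

lemma continuous_map_product_group_mult_right:
  assumes "\<And>i. i \<in> I \<Longrightarrow> group (G i)" and "a \<in> carrier (product_group I G)"
  shows "continuous_map (product_topology (\<lambda>i. discrete_topology (carrier (G i))) I)
           (product_topology (\<lambda>i. discrete_topology (carrier (G i))) I)
           (\<lambda>x. x \<otimes>\<^bsub>product_group I G\<^esub> a)"
  unfolding continuous_map_componentwise
proof (intro conjI ballI)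
  show "(\<lambda>x. x \<otimes>\<^bsub>product_group I G\<^esub> a) ` topspace (product_topology (\<lambda>i. discrete_topology (carrier (G i))) I)
      \<subseteq> extensional I"
    by (simp add: image_subset_iff)
next
  fix k assume k: "k \<in> I"
  have "continuous_map (product_topology (\<lambda>i. discrete_topology (carrier (G i))) I)
          (discrete_topology (carrier (G k))) ((\<lambda>y. y \<otimes>\<^bsub>G k\<^esub> a k) \<circ> (\<lambda>x. x k))"
    using assms k
    by (intro continuous_map_compose[OF continuous_map_product_projection[OF k]])
       (auto simp: PiE_iff group.is_monoid monoid.m_closed)
  then show "continuous_map (product_topology (\<lambda>i. discrete_topology (carrier (G i))) I)
          (discrete_topology (carrier (G k))) (\<lambda>x. (x \<otimes>\<^bsub>product_group I G\<^esub> a) k)"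
    using k by (simp add: o_def)
qed

lemma closedin_rcos_product_group:
  assumes "\<And>i. i \<in> I \<Longrightarrow> group (G i)" and H: "subgroup H (product_group I G)"
    and "closedin (product_topology (\<lambda>i. discrete_topology (carrier (G i))) I) H"
    and a: "a \<in> carrier (product_group I G)"
  shows "closedin (product_topology (\<lambda>i. discrete_topology (carrier (G i))) I)
           (H #>\<^bsub>product_group I G\<^esub> a)"
proof -
  let ?G = "product_group I G"
  let ?X = "product_topology (\<lambda>i. discrete_topology (carrier (G i))) I"
  interpret G: group ?G using assms(1) by simp
  interpret H: subgroup H ?G by fact
  have "x \<in> H #>\<^bsub>?G\<^esub> a \<longleftrightarrow> x \<in> carrier ?G \<and> x \<otimes>\<^bsub>?G\<^esub> inv\<^bsub>?G\<^esub> a \<in> H" for x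
    using H.rcos_module[OF G.is_group a, of x] H.elemrcos_carrier[OF G.is_group a] by blast
  then have coset_eq: "H #>\<^bsub>?G\<^esub> a = {x \<in> topspace ?X. x \<otimes>\<^bsub>?G\<^esub> inv\<^bsub>?G\<^esub> a \<in> H}"
    unfolding topspace_product_topology topspace_discrete_topology carrier_product_group by blast
  have "continuous_map ?X ?X (\<lambda>x. x \<otimes>\<^bsub>?G\<^esub> inv\<^bsub>?G\<^esub> a)"
    using continuous_map_product_group_mult_right[OF assms(1) G.inv_closed[OF a]] .
  from closedin_continuous_map_preimage[OF this assms(3)] show ?thesis
    unfolding coset_eq .
qed

lemma openin_closedin_finite_index_subgroup:
  assumes "\<And>i. i \<in> I \<Longrightarrow> group (G i)" and H: "subgroup H (product_group I G)"
    and "finite (rcosets\<^bsub>product_group I G\<^esub> H)"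
    and "closedin (product_topology (\<lambda>i. discrete_topology (carrier (G i))) I) H"
  shows "openin (product_topology (\<lambda>i. discrete_topology (carrier (G i))) I) H"
proof -
  let ?G = "product_group I G"
  let ?X = "product_topology (\<lambda>i. discrete_topology (carrier (G i))) I"
  interpret G: group ?G using assms(1) by simp
  have "topspace ?X = carrier ?G"
    by (simp only: topspace_product_topology topspace_discrete_topology carrier_product_group)
  then have "H = topspace ?X - \<Union> (rcosets\<^bsub>?G\<^esub> H - {H})"
    using G.Union_rcosets_Diff_self[OF H] subgroup.subset[OF H] by blast
  moreover have "closedin ?X (\<Union> (rcosets\<^bsub>?G\<^esub> H - {H}))"
    using assms(3) closedin_rcos_product_group[OF assms(1) H assms(4)]
    by (intro closedin_Union) (auto simp: RCOSETS_def)
  ultimately show ?thesis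
    by (metis openin_diff openin_topspace)
qed

section \<open>A non-open subgroup of finite index\<close>

definition ultrapower_kernel :: "'i set \<Rightarrow> ('a, 'b) monoid_scheme \<Rightarrow> 'i filter \<Rightarrow> ('i \<Rightarrow> 'a) set"
  where "ultrapower_kernel I S F =
    {g \<in> carrier (product_group I (\<lambda>_. S)). eventually (\<lambda>i. g i = \<one>\<^bsub>S\<^esub>) F}"

lemma subgroup_ultrapower_kernel:
  assumes "group S" and "F \<le> principal I"
  shows "subgroup (ultrapower_kernel I S F) (product_group I (\<lambda>_. S))"
proof -
  interpret S: group S by fact
  have I: "eventually (\<lambda>i. i \<in> I) F"
    using assms(2) by (simp add: le_principal)
  show ?thesis
  proof (rule group.subgroupI)
    show "group (product_group I (\<lambda>_. S))"
      using assms(1) by simp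
    show "ultrapower_kernel I S F \<subseteq> carrier (product_group I (\<lambda>_. S))"
      by (auto simp: ultrapower_kernel_def)
    have "eventually (\<lambda>i. (\<lambda>i\<in>I. \<one>\<^bsub>S\<^esub>) i = \<one>\<^bsub>S\<^esub>) F"
      using I by eventually_elim simp
    then have "(\<lambda>i\<in>I. \<one>\<^bsub>S\<^esub>) \<in> ultrapower_kernel I S F"
      by (simp add: ultrapower_kernel_def)
    then show "ultrapower_kernel I S F \<noteq> {}"
      by blast
  next
    fix a assume "a \<in> ultrapower_kernel I S F"
    then have a: "a \<in> (\<Pi>\<^sub>E i\<in>I. carrier S)" "eventually (\<lambda>i. a i = \<one>\<^bsub>S\<^esub>) F"
      by (auto simp: ultrapower_kernel_def)
    have "eventually (\<lambda>i. (\<lambda>i\<in>I. inv\<^bsub>S\<^esub> a i) i = \<one>\<^bsub>S\<^esub>) F"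
      using a(2) I by eventually_elim simp
    then show "inv\<^bsub>product_group I (\<lambda>_. S)\<^esub> a \<in> ultrapower_kernel I S F"
      using a(1) by (auto simp: ultrapower_kernel_def PiE_iff)
  next
    fix a b assume "a \<in> ultrapower_kernel I S F" "b \<in> ultrapower_kernel I S F"
    then have ab: "a \<in> (\<Pi>\<^sub>E i\<in>I. carrier S)" "b \<in> (\<Pi>\<^sub>E i\<in>I. carrier S)"
      "eventually (\<lambda>i. a i = \<one>\<^bsub>S\<^esub>) F" "eventually (\<lambda>i. b i = \<one>\<^bsub>S\<^esub>) F"
      by (auto simp: ultrapower_kernel_def)
    have "eventually (\<lambda>i. (\<lambda>i\<in>I. a i \<otimes>\<^bsub>S\<^esub> b i) i = \<one>\<^bsub>S\<^esub>) F"
      using ab(3,4) I by eventually_elim simp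
    then show "a \<otimes>\<^bsub>product_group I (\<lambda>_. S)\<^esub> b \<in> ultrapower_kernel I S F"
      using ab(1,2) by (auto simp: ultrapower_kernel_def PiE_iff)
  qed
qed

text \<open>Each coset of the kernel is represented by a constant function, namely the limit
  of any of its elements along the ultrafilter.\<close>
lemma finite_rcosets_ultrapower_kernel:
  assumes "group S" and "finite (carrier S)" and "ultrafilter F" and "F \<le> principal I"
  shows "finite (rcosets\<^bsub>product_group I (\<lambda>_. S)\<^esub> ultrapower_kernel I S F)"
proof -
  let ?G = "product_group I (\<lambda>_. S)"
  let ?K = "ultrapower_kernel I S F"
  interpret S: group S by fact
  interpret G: group ?G using assms(1) by simp
  have K: "subgroup ?K ?G"
    using assms(1,4) by (rule subgroup_ultrapower_kernel)
  have I: "eventually (\<lambda>i. i \<in> I) F"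
    using assms(4) by (simp add: le_principal)
  have "?K #>\<^bsub>?G\<^esub> g \<in> (\<lambda>s. ?K #>\<^bsub>?G\<^esub> (\<lambda>i\<in>I. s)) ` carrier S" if g: "g \<in> carrier ?G" for g
  proof -
    have g_coord: "g i \<in> carrier S" if "i \<in> I" for i
      using g that by auto
    have "eventually (\<lambda>i. \<exists>s\<in>carrier S. g i = s) F"
      using I by (rule eventually_mono) (blast intro: g_coord)
    then obtain s where s: "s \<in> carrier S" "eventually (\<lambda>i. g i = s) F"
      using ultrafilter_eventually_finite_ex[OF assms(3,2), of "\<lambda>s i. g i = s"] by blast
    have "g \<otimes>\<^bsub>?G\<^esub> inv\<^bsub>?G\<^esub> (\<lambda>i\<in>I. s) = (\<lambda>i\<in>I. g i \<otimes>\<^bsub>S\<^esub> inv\<^bsub>S\<^esub> s)"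
      using s(1) S.is_group by (simp add: PiE_iff cong: restrict_cong)
    moreover have "(\<lambda>i\<in>I. g i \<otimes>\<^bsub>S\<^esub> inv\<^bsub>S\<^esub> s) \<in> carrier ?G"
      using g_coord s(1) by auto
    moreover have "eventually (\<lambda>i. (\<lambda>i\<in>I. g i \<otimes>\<^bsub>S\<^esub> inv\<^bsub>S\<^esub> s) i = \<one>\<^bsub>S\<^esub>) F"
      using s(2) I by eventually_elim (use s(1) in simp)
    ultimately have "g \<otimes>\<^bsub>?G\<^esub> inv\<^bsub>?G\<^esub> (\<lambda>i\<in>I. s) \<in> ?K"
      by (simp only: ultrapower_kernel_def mem_Collect_eq)
    moreover have const: "(\<lambda>i\<in>I. s) \<in> carrier ?G"
      using s(1) by simp
    ultimately have "g \<in> ?K #>\<^bsub>?G\<^esub> (\<lambda>i\<in>I. s)"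
      using subgroup.rcos_module[OF K G.is_group const g] by blast
    then have "?K #>\<^bsub>?G\<^esub> g = ?K #>\<^bsub>?G\<^esub> (\<lambda>i\<in>I. s)"
      using G.repr_independence[OF _ const K] by blast
    then show ?thesis
      using s(1) by blast
  qed
  then have "rcosets\<^bsub>?G\<^esub> ?K \<subseteq> (\<lambda>s. ?K #>\<^bsub>?G\<^esub> (\<lambda>i\<in>I. s)) ` carrier S"
    unfolding RCOSETS_def by blast
  then show ?thesis
    using assms(2) finite_subset by blast
qed

lemma not_openin_ultrapower_kernel:
  assumes "group S" and "carrier S \<noteq> {\<one>\<^bsub>S\<^esub>}"
    and "F \<noteq> bot" and "F \<le> principal I" and "F \<le> cofinite"
  shows "\<not> openin (product_topology (\<lambda>_. discrete_topology (carrier S)) I) (ultrapower_kernel I S F)"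
proof
  interpret S: group S by fact
  let ?K = "ultrapower_kernel I S F"
  assume "openin (product_topology (\<lambda>_. discrete_topology (carrier S)) I) ?K"
  moreover have "(\<lambda>i\<in>I. \<one>\<^bsub>S\<^esub>) \<in> ?K"
    using subgroup.one_closed[OF subgroup_ultrapower_kernel[OF assms(1,4)]] by simp
  ultimately obtain V where V: "finite {i \<in> I. V i \<noteq> carrier S}"
    "(\<lambda>i\<in>I. \<one>\<^bsub>S\<^esub>) \<in> Pi\<^sub>E I V" "Pi\<^sub>E I V \<subseteq> ?K"
    unfolding openin_product_topology_alt by force
  obtain s where s: "s \<in> carrier S" "s \<noteq> \<one>\<^bsub>S\<^esub>"
    using assms(2) S.one_closed by blast
  \<comment> \<open>\<open>g\<close> is nontrivial at all but finitely many coordinates, hence \<open>F\<close>-almost everywhere.\<close>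
  define g where "g = (\<lambda>i\<in>I. if V i = carrier S then s else \<one>\<^bsub>S\<^esub>)"
  have "g \<in> Pi\<^sub>E I V"
    using V(2) s(1) by (auto simp: g_def PiE_iff)
  then have "eventually (\<lambda>i. g i = \<one>\<^bsub>S\<^esub>) F"
    using V(3) by (auto simp: ultrapower_kernel_def)
  moreover have "eventually (\<lambda>i. i \<in> I \<and> i \<notin> {i \<in> I. V i \<noteq> carrier S}) F"
    using assms(4,5) V(1) unfolding le_principal
    by (intro eventually_conj) (auto simp: le_filter_def eventually_cofinite)
  ultimately have "eventually (\<lambda>i. False) F"
    by eventually_elim (use s(2) in \<open>auto simp: g_def\<close>)
  with assms(3) show False
    by (simp add: trivial_limit_def)
qed

theorem not_strongly_complete_infinite_power:
  assumes "group S" and "finite (carrier S)" and "carrier S \<noteq> {\<one>\<^bsub>S\<^esub>}" and "infinite I"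
  shows "\<not> strongly_complete (product_group I (\<lambda>_. S))
           (product_topology (\<lambda>_. discrete_topology (carrier S)) I)"
proof -
  have "inf (principal I) cofinite \<noteq> bot"
    using assms(4)
    by (simp add: trivial_limit_def eventually_inf_principal eventually_cofinite inf_commute)
  then obtain F where F: "ultrafilter F" "F \<le> inf (principal I) cofinite"
    using ultrafilter_le_exists by blast
  then have "F \<noteq> bot" "F \<le> principal I" "F \<le> cofinite"
    by (simp_all add: ultrafilter_def)
  then have K: "subgroup (ultrapower_kernel I S F) (product_group I (\<lambda>_. S))"
    "finite (rcosets\<^bsub>product_group I (\<lambda>_. S)\<^esub> ultrapower_kernel I S F)"
    "\<not> openin (product_topology (\<lambda>_. discrete_topology (carrier S)) I) (ultrapower_kernel I S F)"
    using subgroup_ultrapower_kernel[OF assms(1)] finite_rcosets_ultrapower_kernel[OF assms(1,2) F(1)]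
      not_openin_ultrapower_kernel[OF assms(1,3)] by simp_all
  show ?thesis
  proof
    assume "strongly_complete (product_group I (\<lambda>_. S))
      (product_topology (\<lambda>_. discrete_topology (carrier S)) I)"
    with K(1,2) have "openin (product_topology (\<lambda>_. discrete_topology (carrier S)) I)
      (ultrapower_kernel I S F)"
      by (simp add: strongly_complete_def)
    with K(3) show False ..
  qed
qed

section \<open>Normal subgroups of finite index of profinite type\<close>

lemma profinite_group_continuous_mult_left:
  assumes "profinite_group G T" and "a \<in> carrier G"
  shows "continuous_map T T (\<lambda>x. a \<otimes>\<^bsub>G\<^esub> x)"
proof -
  have "continuous_map T (prod_topology T T) (\<lambda>x. (a, x))"
    using assms by (intro continuous_map_pairedI) (auto simp: profinite_group_def)
  then show ?thesis
    using continuous_map_compose assms(1) unfolding profinite_group_def o_def by fastforce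
qed

lemma profinite_group_continuous_mult_right:
  assumes "profinite_group G T" and "a \<in> carrier G"
  shows "continuous_map T T (\<lambda>x. x \<otimes>\<^bsub>G\<^esub> a)"
proof -
  have "continuous_map T (prod_topology T T) (\<lambda>x. (x, a))"
    using assms by (intro continuous_map_pairedI) (auto simp: profinite_group_def)
  then show ?thesis
    using continuous_map_compose assms(1) unfolding profinite_group_def o_def by fastforce
qed

lemma profinite_group_closedin_centralizer:
  assumes "profinite_group G T" and "a \<in> carrier G"
  shows "closedin T {x \<in> carrier G. x \<otimes>\<^bsub>G\<^esub> a = a \<otimes>\<^bsub>G\<^esub> x}"
  using closedin_continuous_maps_eq[of T T "\<lambda>x. x \<otimes>\<^bsub>G\<^esub> a" "\<lambda>x. a \<otimes>\<^bsub>G\<^esub> x"]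
    profinite_group_continuous_mult_left[OF assms] profinite_group_continuous_mult_right[OF assms]
    assms(1)
  by (simp add: profinite_group_def)

definition coord_embed :: "'i set \<Rightarrow> ('a, 'b) monoid_scheme \<Rightarrow> 'i \<Rightarrow> 'a \<Rightarrow> 'i \<Rightarrow> 'a"
  where "coord_embed I S j s = (\<lambda>i\<in>I. if i = j then s else \<one>\<^bsub>S\<^esub>)"

lemma coord_embed_hom:
  assumes "group S" and "j \<in> I"
  shows "coord_embed I S j \<in> hom S (product_group I (\<lambda>_. S))"
  using assms by (auto simp: hom_def coord_embed_def PiE_iff group.is_monoid fun_eq_iff)

lemma coord_embed_commutator:
  assumes "group S" and j: "j \<in> I" and s: "s \<in> carrier S"
    and u: "u \<in> carrier (product_group I (\<lambda>_. S))"
  shows "coord_embed I S j s \<otimes>\<^bsub>product_group I (\<lambda>_. S)\<^esub> u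
      \<otimes>\<^bsub>product_group I (\<lambda>_. S)\<^esub> inv\<^bsub>product_group I (\<lambda>_. S)\<^esub> coord_embed I S j s
      \<otimes>\<^bsub>product_group I (\<lambda>_. S)\<^esub> inv\<^bsub>product_group I (\<lambda>_. S)\<^esub> u
    = coord_embed I S j (s \<otimes>\<^bsub>S\<^esub> u j \<otimes>\<^bsub>S\<^esub> inv\<^bsub>S\<^esub> s \<otimes>\<^bsub>S\<^esub> inv\<^bsub>S\<^esub> u j)"
proof -
  interpret S: group S by fact
  interpret embed: group_hom S "product_group I (\<lambda>_. S)" "coord_embed I S j"
    using coord_embed_hom[OF assms(1) j] assms(1) by (simp add: group_hom_def group_hom_axioms_def)
  have u_carrier: "u \<in> (\<Pi>\<^sub>E i\<in>I. carrier S)"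
    using u by simp
  have inv_d: "inv\<^bsub>product_group I (\<lambda>_. S)\<^esub> coord_embed I S j s = coord_embed I S j (inv\<^bsub>S\<^esub> s)"
    using embed.hom_inv[OF s] by simp
  have inv_u: "inv\<^bsub>product_group I (\<lambda>_. S)\<^esub> u = (\<lambda>i\<in>I. inv\<^bsub>S\<^esub> u i)"
    using u_carrier S.is_group by simp
  have pointwise: "(coord_embed I S j s \<otimes>\<^bsub>product_group I (\<lambda>_. S)\<^esub> u
      \<otimes>\<^bsub>product_group I (\<lambda>_. S)\<^esub> coord_embed I S j (inv\<^bsub>S\<^esub> s)
      \<otimes>\<^bsub>product_group I (\<lambda>_. S)\<^esub> (\<lambda>i\<in>I. inv\<^bsub>S\<^esub> u i)) i
    = coord_embed I S j (s \<otimes>\<^bsub>S\<^esub> u j \<otimes>\<^bsub>S\<^esub> inv\<^bsub>S\<^esub> s \<otimes>\<^bsub>S\<^esub> inv\<^bsub>S\<^esub> u j) i" for i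
    using s u_carrier by (cases "i \<in> I"; cases "i = j") (auto simp: coord_embed_def PiE_iff)
  show ?thesis
    unfolding inv_d inv_u by (rule ext) (rule pointwise)
qed

locale normal_subgroup_of_simple_power =
  fixes S :: "('a, 'b) monoid_scheme" (structure) and I :: "'i set" and U :: "('i \<Rightarrow> 'a) set"
  assumes simple: "simple_group S" and nonabelian: "\<not> comm_group S"
    and normal: "U \<lhd> product_group I (\<lambda>_. S)"
begin

abbreviation G :: "('i \<Rightarrow> 'a) monoid"
  where "G \<equiv> product_group I (\<lambda>_. S)"

abbreviation X :: "('i \<Rightarrow> 'a) topology"
  where "X \<equiv> product_topology (\<lambda>_. discrete_topology (carrier S)) I"

sublocale simple_group S
  by (fact simple)

sublocale U: normal U G
  by (fact normal)

lemma coordinate_full_or_trivial: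
  assumes j: "j \<in> I"
  shows "coord_embed I S j ` carrier S \<subseteq> U \<or> (\<forall>u\<in>U. u j = \<one>)"
proof -
  interpret embed: group_hom S G "coord_embed I S j"
    using coord_embed_hom[OF is_group j] U.is_group by (simp add: group_hom_def group_hom_axioms_def)
  have "{s \<in> carrier S. coord_embed I S j s \<in> U} \<lhd> S"
    using embed.normal_vimage[OF normal] .
  then have "{s \<in> carrier S. coord_embed I S j s \<in> U} = carrier S
      \<or> {s \<in> carrier S. coord_embed I S j s \<in> U} = {\<one>}"
    by (rule no_real_normal_subgroup)
  then show ?thesis
  proof
    assume trivial: "{s \<in> carrier S. coord_embed I S j s \<in> U} = {\<one>}"
    have "u j = \<one>" if u: "u \<in> U" for u
    proof (rule central_eq_one[OF nonabelian])
      have u_carrier: "u \<in> carrier G"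
        using U.subset u by auto
      then show uj: "u j \<in> carrier S"
        using j by auto
      show "\<forall>s\<in>carrier S. s \<otimes> u j = u j \<otimes> s"
      proof
        fix s assume s: "s \<in> carrier S"
        let ?d = "coord_embed I S j s"
        have "?d \<otimes>\<^bsub>G\<^esub> u \<otimes>\<^bsub>G\<^esub> inv\<^bsub>G\<^esub> ?d \<otimes>\<^bsub>G\<^esub> inv\<^bsub>G\<^esub> u \<in> U"
          using subgroup.m_closed[OF U.subgroup_axioms
              U.inv_op_closed2[OF embed.hom_closed[OF s] u] U.m_inv_closed[OF u]] .
        then have "coord_embed I S j (s \<otimes> u j \<otimes> inv s \<otimes> inv u j) \<in> U"
          unfolding coord_embed_commutator[OF is_group j s u_carrier] .
        then have "s \<otimes> u j \<otimes> inv s \<otimes> inv u j \<in> {s \<in> carrier S. coord_embed I S j s \<in> U}"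
          using s uj by simp
        then show "s \<otimes> u j = u j \<otimes> s"
          using commute_of_commutator_eq_one[OF s uj] unfolding trivial by simp
      qed
    qed
    then show ?thesis
      by blast
  qed auto
qed

lemma coordinate_eq_one_iff_commute:
  assumes u: "u \<in> carrier G" and k: "k \<in> I"
  shows "u k = \<one> \<longleftrightarrow>
    (\<forall>s\<in>carrier S. u \<otimes>\<^bsub>G\<^esub> coord_embed I S k s = coord_embed I S k s \<otimes>\<^bsub>G\<^esub> u)"
proof -
  have uk: "u k \<in> carrier S"
    using u k by auto
  have "u \<otimes>\<^bsub>G\<^esub> coord_embed I S k s = coord_embed I S k s \<otimes>\<^bsub>G\<^esub> u \<longleftrightarrow> s \<otimes> u k = u k \<otimes> s"
    if s: "s \<in> carrier S" for s
  proof
    assume "u \<otimes>\<^bsub>G\<^esub> coord_embed I S k s = coord_embed I S k s \<otimes>\<^bsub>G\<^esub> u"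
    from fun_cong[OF this, of k] show "s \<otimes> u k = u k \<otimes> s"
      using k by (simp add: coord_embed_def)
  next
    assume "s \<otimes> u k = u k \<otimes> s"
    show "u \<otimes>\<^bsub>G\<^esub> coord_embed I S k s = coord_embed I S k s \<otimes>\<^bsub>G\<^esub> u"
    proof
      fix i
      show "(u \<otimes>\<^bsub>G\<^esub> coord_embed I S k s) i = (coord_embed I S k s \<otimes>\<^bsub>G\<^esub> u) i"
        using u s \<open>s \<otimes> u k = u k \<otimes> s\<close>
        by (cases "i \<in> I"; cases "i = k") (auto simp: coord_embed_def PiE_iff)
    qed
  qed
  then have "(\<forall>s\<in>carrier S. u \<otimes>\<^bsub>G\<^esub> coord_embed I S k s = coord_embed I S k s \<otimes>\<^bsub>G\<^esub> u)
      \<longleftrightarrow> (\<forall>s\<in>carrier S. s \<otimes> u k = u k \<otimes> s)"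
    by blast
  also have "\<dots> \<longleftrightarrow> u k = \<one>"
    using central_eq_one[OF nonabelian uk] uk by auto
  finally show ?thesis
    by blast
qed

context
  fixes T :: "('i \<Rightarrow> 'a) topology"
  assumes profinite: "profinite_group (G\<lparr>carrier := U\<rparr>) T"
begin

lemma topspace_profinite: "topspace T = U"
  using profinite by (simp add: profinite_group_def)

lemma closedin_coordinate_fibre_one:
  assumes k: "k \<in> I" and full: "coord_embed I S k ` carrier S \<subseteq> U"
  shows "closedin T {u \<in> U. u k = \<one>}"
proof -
  have "{u \<in> U. u k = \<one>} = (\<Inter>s\<in>carrier S. {u \<in> U. u \<otimes>\<^bsub>G\<^esub> coord_embed I S k s = coord_embed I S k s \<otimes>\<^bsub>G\<^esub> u})"
  proof (intro equalityI subsetI)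
    fix u assume "u \<in> {u \<in> U. u k = \<one>}"
    then show "u \<in> (\<Inter>s\<in>carrier S. {u \<in> U. u \<otimes>\<^bsub>G\<^esub> coord_embed I S k s = coord_embed I S k s \<otimes>\<^bsub>G\<^esub> u})"
      using coordinate_eq_one_iff_commute[OF _ k, of u] U.subset by blast
  next
    fix u assume u: "u \<in> (\<Inter>s\<in>carrier S. {u \<in> U. u \<otimes>\<^bsub>G\<^esub> coord_embed I S k s = coord_embed I S k s \<otimes>\<^bsub>G\<^esub> u})"
    then have "u \<in> U"
      using one_closed by blast
    with u show "u \<in> {u \<in> U. u k = \<one>}"
      using coordinate_eq_one_iff_commute[OF _ k, of u] U.subset by blast
  qed
  moreover have "closedin T {u \<in> U. u \<otimes>\<^bsub>G\<^esub> coord_embed I S k s = coord_embed I S k s \<otimes>\<^bsub>G\<^esub> u}"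
    if "s \<in> carrier S" for s
    using profinite_group_closedin_centralizer[OF profinite, of "coord_embed I S k s"] full that
    by auto
  ultimately show ?thesis
    by (auto intro: closedin_Inter)
qed

lemma closedin_coordinate_fibre:
  assumes k: "k \<in> I" and t: "t \<in> carrier S"
  shows "closedin T {u \<in> U. u k = t}"
  using coordinate_full_or_trivial[OF k]
proof
  assume full: "coord_embed I S k ` carrier S \<subseteq> U"
  \<comment> \<open>The fibre over \<open>t\<close> is the translate of the fibre over \<open>\<one>\<close> by an element of \<open>U\<close>.\<close>
  let ?d = "coord_embed I S k (inv t)"
  have d: "?d \<in> U"
    using full t by auto
  have "u \<otimes>\<^bsub>G\<^esub> ?d \<in> U \<and> (u \<otimes>\<^bsub>G\<^esub> ?d) k = \<one> \<longleftrightarrow> u k = t" if u: "u \<in> U" for u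
  proof -
    have uk: "u k \<in> carrier S"
      using U.subset u k by auto
    have "(u \<otimes>\<^bsub>G\<^esub> ?d) k = u k \<otimes> inv t"
      using k by (simp add: coord_embed_def)
    moreover have "u k \<otimes> inv t = \<one> \<longleftrightarrow> u k = t"
      using inv_solve_right[OF one_closed uk t] t by auto
    ultimately show ?thesis
      using subgroup.m_closed[OF U.subgroup_axioms u d] by simp
  qed
  then have "{u \<in> U. u k = t} = {u \<in> topspace T. u \<otimes>\<^bsub>G\<^esub> ?d \<in> {u \<in> U. u k = \<one>}}"
    unfolding topspace_profinite by blast
  then show ?thesis
    using closedin_continuous_map_preimage[OF profinite_group_continuous_mult_right[OF profinite]
        closedin_coordinate_fibre_one[OF k full]] d
    by simp
next
  assume "\<forall>u\<in>U. u k = \<one>"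
  then have "{u \<in> U. u k = t} = (if t = \<one> then topspace T else {})"
    using topspace_profinite by auto
  then show ?thesis
    by simp
qed

lemma continuous_map_inclusion:
  assumes "finite (carrier S)"
  shows "continuous_map T X (\<lambda>u. u)"
  unfolding continuous_map_componentwise
proof (intro conjI ballI)
  show "(\<lambda>u. u) ` topspace T \<subseteq> extensional I"
    using U.subset topspace_profinite by (auto simp: PiE_def)
  fix k assume k: "k \<in> I"
  show "continuous_map T (discrete_topology (carrier S)) (\<lambda>u. u k)"
    unfolding continuous_map_def
  proof (intro conjI allI impI)
    show "(\<lambda>u. u k) \<in> topspace T \<rightarrow> topspace (discrete_topology (carrier S))"
      using U.subset topspace_profinite k by auto
    fix V
    have "{u \<in> topspace T. u k \<in> V} = topspace T - (\<Union>t\<in>carrier S - V. {u \<in> U. u k = t})"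
      using U.subset topspace_profinite k by auto
    moreover have "closedin T (\<Union>t\<in>carrier S - V. {u \<in> U. u k = t})"
      using assms closedin_coordinate_fibre[OF k] by (auto intro: closedin_Union)
    ultimately show "openin T {u \<in> topspace T. u k \<in> V}"
      by (simp add: openin_diff)
  qed
qed

end

lemma openin_if_profinite_type:
  assumes "profinite_type (G\<lparr>carrier := U\<rparr>)" and "finite (carrier S)"
    and "finite (rcosets\<^bsub>G\<^esub> U)"
  shows "openin X U"
proof -
  obtain T where T: "profinite_group (G\<lparr>carrier := U\<rparr>) T"
    using assms(1) by (auto simp: profinite_type_def)
  have "compact_space T"
    using T by (simp add: profinite_group_def)
  from image_compactin[OF this[unfolded compact_space_def] continuous_map_inclusion[OF T assms(2)]]
  have "compactin X U"
    using topspace_profinite[OF T] by simp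
  moreover have "Hausdorff_space X"
    by (simp add: Hausdorff_space_product_topology)
  ultimately have "closedin X U"
    by (simp add: compactin_imp_closedin)
  then show ?thesis
    using openin_closedin_finite_index_subgroup[of I "\<lambda>_. S" U] U.subgroup_axioms assms(3)
      is_group by simp
qed

end

theorem mainTheorem10:
  fixes S :: "('a, 'b) monoid_scheme" and I :: "'i set"
  assumes "simple_group S" and "finite (carrier S)" and "\<not> comm_group S"
    and "infinite I"
  shows "\<not> strongly_complete (product_group I (\<lambda>_. S))
                (product_topology (\<lambda>_. discrete_topology (carrier S)) I)
       \<and> (\<forall>U. U \<lhd> product_group I (\<lambda>_. S) \<and> finite (rcosets\<^bsub>product_group I (\<lambda>_. S)\<^esub> U)
              \<longrightarrow> openin (product_topology (\<lambda>_. discrete_topology (carrier S)) I) U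
                  \<or> \<not> profinite_type ((product_group I (\<lambda>_. S))\<lparr>carrier := U\<rparr>))"
proof (intro conjI allI impI)
  interpret S: simple_group S
    by fact
  show "\<not> strongly_complete (product_group I (\<lambda>_. S))
      (product_topology (\<lambda>_. discrete_topology (carrier S)) I)"
    using not_strongly_complete_infinite_power[OF S.is_group assms(2) S.simple_not_triv assms(4)] .
  fix U
  assume U: "U \<lhd> product_group I (\<lambda>_. S) \<and> finite (rcosets\<^bsub>product_group I (\<lambda>_. S)\<^esub> U)"
  interpret normal_subgroup_of_simple_power S I U
    using assms(1,3) U by (intro normal_subgroup_of_simple_power.intro) simp_all
  show "openin (product_topology (\<lambda>_. discrete_topology (carrier S)) I) U
      \<or> \<not> profinite_type ((product_group I (\<lambda>_. S))\<lparr>carrier := U\<rparr>)"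
    using openin_if_profinite_type assms(2) U by blast
qed

end
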